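(* Let $H\neq K_q^+$ be a constraint graph, let $G=(V,E)$ be an $H$-colorable graph with $n$ vertices, and let $\hat G$ be the output of the algorithm below run on $L$ independent samples from $\pi_G$. Then for all $\varepsilon\in(0,1)$ and $\gamma\in(0,1)$, $\Pr\big[\|\pi_G-\pi_{\hat G}\|_{TV}<\gamma\big]\ge 1-\varepsilon$ provided $L\ge 4\gamma^{-1}n^2\log\big(\frac{n^2}{2\varepsilon}\big)$.
   Context: A constraint graph $H$ is an undirected connected graph on $\{1,\dots,q\}$ (colors), possibly with self-loops, no parallel edges; $K_q^+$ is the complete graph on $q$ vertices with a self-loop at every vertex. Colors $a,b$ are incompatible if $\{a,b\}\notin E(H)$. An $H$-coloring of $G=(V,E)$ is a map $\sigma:V\to\{1,\dots,q\}$ with $\{\sigma(x),\sigma(y)\}\in E(H)$ for all $\{x,y\}\in E$; $\Omega_G$ is the set of $H$-colorings and $\pi_G$ the uniform distribution on $\Omega_G$. The algorithm: given samples $\sigma^{(1)},\dots,\sigma^{(L)}$, output $\hat G=(V,\hat E)$ where, for distinct $u,v\in V$, $\{u,v\}\notin\hat E$ if and only if $u$ and $v$ receive incompatible colors in at least one of the samples. *)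

theory Defs
  imports "HOL-Probability.Probability"
begin

definition simple_graph :: "'a set \<Rightarrow> 'a set set \<Rightarrow> bool" where
  "simple_graph V E \<longleftrightarrow> finite V \<and> E \<subseteq> {{u, v} | u v. u \<in> V \<and> v \<in> V \<and> u \<noteq> v}"

text \<open>The vertices (colors) of a constraint graph are \<open>{1..q}\<close>. Its edges are unordered pairs
  \<open>{a, b}\<close> in which \<open>a = b\<close> is allowed, so that a self-loop at \<open>a\<close> is the singleton \<open>{a}\<close>.\<close>

definition complete_looped_edges :: "nat \<Rightarrow> nat set set" where
  "complete_looped_edges q = {{a, b} | a b. a \<in> {1..q} \<and> b \<in> {1..q}}"

definition constraint_graph :: "nat \<Rightarrow> nat set set \<Rightarrow> bool" where
  "constraint_graph q F \<longleftrightarrow> q \<ge> 1 \<and> F \<subseteq> complete_looped_edges q \<and>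
     (\<forall>a\<in>{1..q}. \<forall>b\<in>{1..q}. (a, b) \<in> {(x, y). {x, y} \<in> F}\<^sup>*)"

definition incompatible :: "nat set set \<Rightarrow> nat \<Rightarrow> nat \<Rightarrow> bool" where
  "incompatible F a b \<longleftrightarrow> {a, b} \<notin> F"

definition H_colorings :: "nat \<Rightarrow> nat set set \<Rightarrow> 'a set \<Rightarrow> 'a set set \<Rightarrow> ('a \<Rightarrow> nat) set" where
  "H_colorings q F V E =
     {\<sigma> \<in> V \<rightarrow>\<^sub>E {1..q}. \<forall>x y. {x, y} \<in> E \<longrightarrow> {\<sigma> x, \<sigma> y} \<in> F}"

text \<open>The following distribution is meaningful only when an \<open>H\<close>-coloring exists, since
  \<^const>\<open>pmf_of_set\<close> is unspecified on the empty set. Every sample is an \<open>H\<close>-coloring of the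
  graph learned from it, so that graph is \<open>H\<close>-colorable as soon as there is one sample (and,
  having no edges, also if there is at most one vertex).\<close>

definition uniform_coloring :: "nat \<Rightarrow> nat set set \<Rightarrow> 'a set \<Rightarrow> 'a set set \<Rightarrow> ('a \<Rightarrow> nat) pmf" where
  "uniform_coloring q F V E = pmf_of_set (H_colorings q F V E)"

definition learned_edges ::
  "nat set set \<Rightarrow> 'a set \<Rightarrow> nat \<Rightarrow> (nat \<Rightarrow> 'a \<Rightarrow> nat) \<Rightarrow> 'a set set" where
  "learned_edges F V L \<sigma> =
     {{u, v} | u v. u \<in> V \<and> v \<in> V \<and> u \<noteq> v \<and>
        \<not> (\<exists>i\<in>{1..L}. incompatible F (\<sigma> i u) (\<sigma> i v))}"

lemma not_in_learned_edges_iff: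
  assumes "u \<in> V" "v \<in> V" "u \<noteq> v"
  shows "{u, v} \<notin> learned_edges F V L \<sigma> \<longleftrightarrow> (\<exists>i\<in>{1..L}. incompatible F (\<sigma> i u) (\<sigma> i v))"
  using assms
  by (auto simp: learned_edges_def incompatible_def doubleton_eq_iff insert_commute)

definition tv_dist :: "'c pmf \<Rightarrow> 'c pmf \<Rightarrow> real" where
  "tv_dist \<mu> \<nu> = (1 / 2) * (\<Sum>\<^sub>\<infinity>x\<in>UNIV. \<bar>pmf \<mu> x - pmf \<nu> x\<bar>)"

end

theory Submission
  imports Defs
begin

text \<open>Every sample is an \<open>H\<close>-coloring of \<open>G\<close>, so the learned graph contains \<open>G\<close> and has fewer
  colorings. Hence the total variation distance is the probability that a uniform coloring of \<open>G\<close>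
  violates some learned edge, at most the sum of the individual violation probabilities. With
  threshold \<open>\<gamma> / n\<^sup>2\<close>, a union bound shows that with probability at least \<open>1 - \<epsilon>\<close> every pair whose
  violation probability reaches the threshold is caught by a sample.\<close>

section \<open>Colorings and total variation distance\<close>

lemma finite_H_colorings:
  assumes "finite V"
  shows "finite (H_colorings q F V E)"
  by (rule finite_subset[OF _ finite_PiE[OF assms, of "\<lambda>_. {1..q}"]]) (auto simp: H_colorings_def)

text \<open>The uniform law on \<open>A\<close> has the larger mass exactly off \<open>B\<close>,
  where its surplus is \<open>1 / card A\<close> per point. Both laws have total mass one, so the
  opposite surplus on \<open>B\<close> has the same total, and the factor \<open>1 / 2\<close> in
  \<open>tv_dist\<close> cancels the doubling.\<close>

lemma tv_dist_pmf_of_set_subset: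
  assumes "finite A" "B \<subseteq> A" "B \<noteq> {}"
  shows "tv_dist (pmf_of_set A) (pmf_of_set B) = measure_pmf.prob (pmf_of_set A) (A - B)"
proof -
  have fB: "finite B" and A: "A \<noteq> {}"
    using assms finite_subset by auto
  have cB: "0 < card B" and le: "card B \<le> card A"
    using assms fB by (auto simp: card_gt_0_iff card_mono)
  let ?d = "\<lambda>x. \<bar>pmf (pmf_of_set A) x - pmf (pmf_of_set B) x\<bar>"
  have "(\<Sum>\<^sub>\<infinity>x\<in>UNIV. ?d x) = (\<Sum>\<^sub>\<infinity>x\<in>A. ?d x)"
    using assms A fB by (intro infsum_cong_neutral) (auto simp: indicator_def)
  also have "\<dots> = (\<Sum>x\<in>A. ?d x)"
    using assms by simp
  also have "\<dots> = (\<Sum>x\<in>A - B. ?d x) + (\<Sum>x\<in>B. ?d x)"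
    using assms by (simp add: sum.subset_diff)
  also have "(\<Sum>x\<in>A - B. ?d x) = (\<Sum>x\<in>A - B. 1 / card A)"
    using assms A fB by (intro sum.cong) (auto simp: indicator_def)
  \<comment> \<open>On \<open>B\<close> the sign inside the absolute value is settled by
    \<open>card B \<le> card A\<close>.\<close>
  also have "(\<Sum>x\<in>B. ?d x) = (\<Sum>x\<in>B. 1 / card B - 1 / card A)"
  proof (intro sum.cong refl)
    fix x assume x: "x \<in> B"
    have "1 / real (card A) \<le> 1 / real (card B)"
      using cB le by (intro divide_left_mono) auto
    then show "?d x = 1 / card B - 1 / card A"
      using assms A fB x by (auto simp: indicator_def)
  qed
  also have "(\<Sum>x\<in>A - B. 1 / card A) + (\<Sum>x\<in>B. 1 / card B - 1 / card A)
      = 2 * (real (card (A - B)) / card A)"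
    using cB le fB A assms by (simp add: card_Diff_subset of_nat_diff diff_divide_distrib algebra_simps)
  finally show ?thesis
    using assms A by (simp add: tv_dist_def measure_pmf_of_set Int_absorb1)
qed

text \<open>A coloring lost in passing from \<open>E\<close> to \<open>E'\<close> gives incompatible
  colors to the ends of some edge of \<open>E'\<close>, so the union bound applies. The sum runs
  over ordered pairs and counts each edge twice; the later estimate counts ordered pairs as
  well.\<close>

lemma tv_dist_uniform_coloring_le:
  assumes "finite V" "E \<subseteq> E'" "H_colorings q F V E' \<noteq> {}"
    and E': "E' \<subseteq> {{u, v} | u v. u \<in> V \<and> v \<in> V \<and> u \<noteq> v}"
  shows "tv_dist (uniform_coloring q F V E) (uniform_coloring q F V E')
    \<le> (\<Sum>(u, v)\<in>{(u, v). u \<in> V \<and> v \<in> V \<and> u \<noteq> v \<and> {u, v} \<in> E'}.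
         measure_pmf.prob (uniform_coloring q F V E) {\<sigma>. incompatible F (\<sigma> u) (\<sigma> v)})"
proof -
  let ?A = "H_colorings q F V E" and ?B = "H_colorings q F V E'"
  let ?P = "{(u, v). u \<in> V \<and> v \<in> V \<and> u \<noteq> v \<and> {u, v} \<in> E'}"
  let ?I = "\<lambda>p. {\<sigma>. incompatible F (\<sigma> (fst p)) (\<sigma> (snd p))}"
  have fP: "finite ?P"
    by (rule finite_subset[of _ "V \<times> V"]) (use assms in auto)
  have sub: "?B \<subseteq> ?A"
    using assms(2) by (auto simp: H_colorings_def)
  have cover: "?A - ?B \<subseteq> (\<Union>p\<in>?P. ?I p)"
  proof
    fix \<sigma> assume \<sigma>: "\<sigma> \<in> ?A - ?B"
    then obtain x y where xy: "{x, y} \<in> E'" "{\<sigma> x, \<sigma> y} \<notin> F"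
      by (auto simp: H_colorings_def)
    then have "(x, y) \<in> ?P"
      using E' by (auto simp: doubleton_eq_iff)
    then show "\<sigma> \<in> (\<Union>p\<in>?P. ?I p)"
      using xy by (intro UN_I[of "(x, y)"]) (auto simp: incompatible_def)
  qed
  have "tv_dist (uniform_coloring q F V E) (uniform_coloring q F V E')
      = measure_pmf.prob (uniform_coloring q F V E) (?A - ?B)"
    unfolding uniform_coloring_def
    by (intro tv_dist_pmf_of_set_subset finite_H_colorings assms sub)
  also have "\<dots> \<le> measure_pmf.prob (uniform_coloring q F V E) (\<Union>p\<in>?P. ?I p)"
    by (intro measure_pmf.finite_measure_mono cover) auto
  also have "\<dots> \<le> (\<Sum>p\<in>?P. measure_pmf.prob (uniform_coloring q F V E) (?I p))"
    by (intro measure_pmf.finite_measure_subadditive_finite fP) auto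
  finally show ?thesis
    by (simp add: case_prod_beta)
qed

section \<open>The learned graph: its colorings and its measurability\<close>

lemma learned_edges_subset:
  "learned_edges F V L \<sigma> \<subseteq> {{u, v} | u v. u \<in> V \<and> v \<in> V \<and> u \<noteq> v}"
  by (auto simp: learned_edges_def)

lemma subset_learned_edges:
  assumes "simple_graph V E" "\<And>i. i \<in> {1..L} \<Longrightarrow> \<sigma> i \<in> H_colorings q F V E"
  shows "E \<subseteq> learned_edges F V L \<sigma>"
proof
  fix e assume e: "e \<in> E"
  then obtain u v where uv: "e = {u, v}" "u \<in> V" "v \<in> V" "u \<noteq> v"
    using assms(1) by (auto simp: simple_graph_def)
  have "\<not> incompatible F (\<sigma> i u) (\<sigma> i v)" if "i \<in> {1..L}" for i
    using assms(2)[OF that] e uv(1) by (auto simp: H_colorings_def incompatible_def)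
  then show "e \<in> learned_edges F V L \<sigma>"
    using not_in_learned_edges_iff[OF uv(2-4)] uv(1) by blast
qed

text \<open>A pair that sample \<open>i\<close> colors incompatibly is no learned edge, so the
  sample stays proper. This makes the uniform distribution on colorings of the learned graph
  meaningful once there is a sample.\<close>

lemma sample_in_learned_colorings:
  assumes "\<sigma> i \<in> H_colorings q F V E" "i \<in> {1..L}"
  shows "\<sigma> i \<in> H_colorings q F V (learned_edges F V L \<sigma>)"
proof -
  have "{\<sigma> i x, \<sigma> i y} \<in> F" if xy: "{x, y} \<in> learned_edges F V L \<sigma>" for x y
  proof -
    have "x \<in> V" "y \<in> V" "x \<noteq> y"
      using xy learned_edges_subset[of F V L \<sigma>] by (auto simp: doubleton_eq_iff)
    from not_in_learned_edges_iff[OF this, of F L \<sigma>] show ?thesis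
      using xy assms(2) by (auto simp: incompatible_def)
  qed
  then show ?thesis
    using assms(1) by (simp add: H_colorings_def)
qed

text \<open>The learned edge set takes values in the finite set \<open>Pow (Pow V)\<close>, so it
  suffices to treat preimages of singletons. These are finite conjunctions of conditions on which
  \<open>e\<close> belong, and each membership is a finite combination of predicates of the
  samples.\<close>

lemma measurable_learned_edges:
  assumes "finite V" and X: "\<And>i. i \<in> {1..L} \<Longrightarrow> X i \<in> measurable M (count_space UNIV)"
  shows "(\<lambda>\<omega>. learned_edges F V L (\<lambda>i. X i \<omega>)) \<in> measurable M (count_space UNIV)"
proof -
  let ?f = "\<lambda>\<omega>. learned_edges F V L (\<lambda>i. X i \<omega>)"
  have sub: "?f \<omega> \<subseteq> Pow V" for \<omega>
    by (auto simp: learned_edges_def)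
  have pred: "Measurable.pred M (\<lambda>\<omega>. incompatible F (X i \<omega> u) (X i \<omega> v))" if "i \<in> {1..L}" for i u v
    using measurable_compose[OF X[OF that], of "\<lambda>\<sigma>. incompatible F (\<sigma> u) (\<sigma> v)" "count_space UNIV"]
    by simp
  have mem: "Measurable.pred M (\<lambda>\<omega>. e \<in> ?f \<omega>)" for e
  proof (cases "\<exists>u v. e = {u, v} \<and> u \<in> V \<and> v \<in> V \<and> u \<noteq> v")
    case True
    then obtain u v where uv: "e = {u, v}" "u \<in> V" "v \<in> V" "u \<noteq> v"
      by blast
    have "(e \<in> ?f \<omega>) = (\<not> (\<exists>i\<in>{1..L}. incompatible F (X i \<omega> u) (X i \<omega> v)))" for \<omega>
      using not_in_learned_edges_iff[OF uv(2-4), of F L "\<lambda>i. X i \<omega>"] uv(1) by blast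
    moreover have "Measurable.pred M (\<lambda>\<omega>. \<not> (\<exists>i\<in>{1..L}. incompatible F (X i \<omega> u) (X i \<omega> v)))"
      by (intro pred_intros_logic pred_intros_finite pred) auto
    ultimately show ?thesis
      by simp
  next
    case False
    then have "e \<notin> ?f \<omega>" for \<omega>
      using learned_edges_subset[of F V L "\<lambda>i. X i \<omega>"] by blast
    then show ?thesis
      by simp
  qed
  have "?f \<in> measurable M (count_space (Pow (Pow V)))"
  proof (subst measurable_count_space_eq2, use assms in simp, intro conjI ballI)
    show "?f \<in> space M \<rightarrow> Pow (Pow V)"
      using sub by auto
    fix S assume S: "S \<in> Pow (Pow V)"
    have "?f \<omega> = S \<longleftrightarrow> (\<forall>e\<in>Pow V. e \<in> ?f \<omega> \<longleftrightarrow> e \<in> S)" for \<omega>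
      using S sub[of \<omega>] by blast
    then have "?f -` {S} \<inter> space M = {\<omega> \<in> space M. \<forall>e\<in>Pow V. e \<in> ?f \<omega> \<longleftrightarrow> e \<in> S}"
      by auto
    moreover have "Measurable.pred M (\<lambda>\<omega>. \<forall>e\<in>Pow V. e \<in> ?f \<omega> \<longleftrightarrow> e \<in> S)"
      using assms(1) by (intro pred_intros_finite pred_intros_logic mem) auto
    ultimately show "?f -` {S} \<inter> space M \<in> sets M"
      by (simp add: pred_def)
  qed
  \<comment> \<open>Composing with the identity enlarges the discrete target space to
    \<open>UNIV\<close>.\<close>
  from measurable_compose[OF this, of "\<lambda>x. x" "count_space UNIV"] show ?thesis
    by simp
qed

section \<open>Probability that independent samples all miss a set, and the choice of sample
  size\<close>

lemma (in prob_space) prob_never_le_exp: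
  fixes L :: nat
  assumes ind: "indep_vars (\<lambda>_. count_space UNIV) X {1..L}"
    and dist: "\<And>i. i \<in> {1..L} \<Longrightarrow> distr M (count_space UNIV) (X i) = measure_pmf \<mu>"
    and t: "t \<le> measure_pmf.prob \<mu> A"
  shows "prob {\<omega> \<in> space M. \<forall>i\<in>{1..L}. X i \<omega> \<notin> A} \<le> exp (- t * L)"
\<comment> \<open>Without samples the event is all of \<open>space M\<close> and the bound is 1. The
  case is separate because an empty intersection would be \<open>UNIV\<close>, and the product rule
  for independence wants a nonempty index set.\<close>
proof (cases "L = 0")
  case True
  then show ?thesis
    by simp
next
  case False
  have X: "X i \<in> measurable M (count_space UNIV)" if "i \<in> {1..L}" for i
    using ind that by (auto simp: indep_vars_def)
  have "prob (X i -` (- A) \<inter> space M) = 1 - measure_pmf.prob \<mu> A" if "i \<in> {1..L}" for i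
  proof -
    have "prob (X i -` (- A) \<inter> space M) = measure (distr M (count_space UNIV) (X i)) (- A)"
      using X[OF that] by (simp add: measure_distr)
    also have "\<dots> = measure_pmf.prob \<mu> (space (measure_pmf \<mu>) - A)"
      by (simp add: dist[OF that] Compl_eq_Diff_UNIV)
    also have "\<dots> = 1 - measure_pmf.prob \<mu> A"
      by (subst measure_pmf.prob_compl) auto
    finally show ?thesis .
  qed
  moreover have "{\<omega> \<in> space M. \<forall>i\<in>{1..L}. X i \<omega> \<notin> A} = (\<Inter>i\<in>{1..L}. X i -` (- A) \<inter> space M)"
    using False by auto
  \<comment> \<open>Independence yields a product of \<open>L\<close> equal factors.\<close>
  ultimately have "prob {\<omega> \<in> space M. \<forall>i\<in>{1..L}. X i \<omega> \<notin> A} = (1 - measure_pmf.prob \<mu> A) ^ L"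
    using indep_varsD[OF ind, of "{1..L}" "\<lambda>_. - A"] False by simp
  \<comment> \<open>The base is nonnegative, being the probability of a complement, and is at most
    \<open>1 - t\<close>, hence at most \<open>exp (- t)\<close>.\<close>
  also have "\<dots> \<le> exp (- t) ^ L"
    using t exp_ge_add_one_self[of "- t"] by (intro power_mono) auto
  also have "\<dots> = exp (- t * L)"
    by (simp add: exp_of_nat_mult[symmetric] mult.commute)
  finally show ?thesis .
qed

text \<open>With \<open>r = n^2 / (2 * \<epsilon>)\<close>, the bound on \<open>x\<close> makes the
  exponential at most \<open>r^(-4)\<close>. Writing \<open>n^2\<close> as
  \<open>2 * \<epsilon> * r\<close> cancels one power and leaves
  \<open>2 * \<epsilon> / r^3\<close>, where \<open>r\<close> is at least 2.\<close>

lemma threshold_union_bound: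
  fixes n :: nat and \<epsilon> \<gamma> x :: real
  assumes "2 \<le> n" "0 < \<epsilon>" "\<epsilon> < 1" "0 < \<gamma>"
    and x: "x \<ge> 4 * inverse \<gamma> * (real n)\<^sup>2 * ln ((real n)\<^sup>2 / (2 * \<epsilon>))"
  shows "(real n)\<^sup>2 * exp (- (\<gamma> / (real n)\<^sup>2) * x) \<le> \<epsilon>"
proof -
  have n: "4 \<le> (real n)\<^sup>2"
    using assms(1) power_mono[of 2 "real n" 2] by simp
  define r where "r = (real n)\<^sup>2 / (2 * \<epsilon>)"
  have r: "2 \<le> r"
    using assms n by (simp add: r_def field_simps)
  have "4 * ln r \<le> \<gamma> / (real n)\<^sup>2 * x"
    using x n assms by (simp add: r_def field_simps)
  then have "exp (- (\<gamma> / (real n)\<^sup>2) * x) \<le> exp (- (4 * ln r))"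
    by simp
  also have "\<dots> = inverse (r ^ 4)"
    using r exp_of_nat_mult[of 4 "ln r"] by (simp add: exp_minus)
  finally have "(real n)\<^sup>2 * exp (- (\<gamma> / (real n)\<^sup>2) * x) \<le> (real n)\<^sup>2 * inverse (r ^ 4)"
    by (intro mult_left_mono) auto
  also have "\<dots> = 2 * \<epsilon> * inverse (r ^ 3)"
  proof -
    have "(real n)\<^sup>2 = 2 * \<epsilon> * r"
      using assms by (simp add: r_def)
    then show ?thesis
      using r by (simp add: field_simps eval_nat_numeral)
  qed
  also have "\<dots> \<le> 2 * \<epsilon> * inverse 2"
  proof -
    have "2 ^ 3 \<le> r ^ 3"
      using r by (intro power_mono) auto
    then have "2 \<le> r ^ 3"
      by simp
    then show ?thesis
      using assms by (intro mult_left_mono le_imp_inverse_le) auto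
  qed
  finally show ?thesis
    by simp
qed

section \<open>Catching the frequently violated pairs, and accuracy of the learned graph\<close>

theorem theorem10:
  fixes q n L :: nat and F :: "nat set set"
    and V :: "'a set" and E :: "'a set set"
    and M :: "'b measure" and X :: "nat \<Rightarrow> 'b \<Rightarrow> 'a \<Rightarrow> nat"
    and \<epsilon> \<gamma> :: real
  assumes "constraint_graph q F" and "F \<noteq> complete_looped_edges q"
    and "simple_graph V E" and "card V = n" and "H_colorings q F V E \<noteq> {}"
    and "prob_space M"
    and "prob_space.indep_vars M (\<lambda>_. count_space UNIV) X {1..L}"
    and "\<And>i. i \<in> {1..L} \<Longrightarrow>
           distr M (count_space UNIV) (X i) = measure_pmf (uniform_coloring q F V E)"
    and "0 < \<epsilon>" and "\<epsilon> < 1" and "0 < \<gamma>" and "\<gamma> < 1"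
    and "real L \<ge> 4 * inverse \<gamma> * (real n)\<^sup>2 * ln ((real n)\<^sup>2 / (2 * \<epsilon>))"
  shows "measure M {\<omega> \<in> space M.
           tv_dist (uniform_coloring q F V E)
             (uniform_coloring q F V (learned_edges F V L (\<lambda>i. X i \<omega>))) < \<gamma>} \<ge> 1 - \<epsilon>"
proof -
  interpret prob_space M by fact
  let ?\<mu> = "uniform_coloring q F V E"
  let ?E = "\<lambda>\<omega>. learned_edges F V L (\<lambda>i. X i \<omega>)"
  have fV: "finite V"
    using assms(3) by (simp add: simple_graph_def)
  show ?thesis
  \<comment> \<open>Here the logarithm may be nonpositive, so \<open>L = 0\<close> is possible.
    Neither graph has edges, and the two distributions coincide.\<close>
  proof (cases "n \<le> 1")
    case True
    then have "u = v" if "u \<in> V" "v \<in> V" for u v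
      using that assms(4) fV by (auto simp: card_le_Suc0_iff_eq)
    then have "E = {}" "?E \<omega> = {}" for \<omega>
      using assms(3) unfolding simple_graph_def learned_edges_def by blast+
    then show ?thesis
      using assms by (simp add: tv_dist_def prob_space)
  next
    case False
    then have n: "2 \<le> n"
      by simp
    have X: "X i \<in> measurable M (count_space UNIV)" if "i \<in> {1..L}" for i
      using assms(7) that by (auto simp: indep_vars_def)
    \<comment> \<open>Positivity of the logarithm forces at least one sample, which later witnesses
      that the learned graph is colorable.\<close>
    have "4 \<le> (real n)\<^sup>2"
      using n power_mono[of 2 "real n" 2] by simp
    then have "1 < (real n)\<^sup>2 / (2 * \<epsilon>)"
      using assms(9,10) by (simp add: field_simps)
    then have "0 < 4 * inverse \<gamma> * (real n)\<^sup>2 * ln ((real n)\<^sup>2 / (2 * \<epsilon>))"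
      using assms(11) n by (intro mult_pos_pos) auto
    then have L: "0 < L"
      using assms(13) by linarith
    define t where "t = \<gamma> / (real n)\<^sup>2"
    define I :: "'a \<times> 'a \<Rightarrow> ('a \<Rightarrow> nat) set"
      where "I = (\<lambda>(u, v). {\<sigma>. incompatible F (\<sigma> u) (\<sigma> v)})"
    \<comment> \<open>\<open>P\<close> holds the ordered pairs that some sample has to separate;
      \<open>B p\<close> is the event that all samples fail to separate \<open>p\<close>.\<close>
    define P where "P = {p \<in> V \<times> V. fst p \<noteq> snd p \<and> t \<le> measure_pmf.prob ?\<mu> (I p)}"
    define B where "B = (\<lambda>p. {\<omega> \<in> space M. \<forall>i\<in>{1..L}. X i \<omega> \<notin> I p})"
    have fP: "finite P"
      unfolding P_def using fV by simp
    have cP: "card P \<le> n\<^sup>2"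
      using card_mono[of "V \<times> V" P] fV assms(4)
      by (auto simp: P_def card_cartesian_product power2_eq_square)
    have B: "B p \<in> sets M" for p
    proof -
      have "Measurable.pred M (\<lambda>\<omega>. \<forall>i\<in>{1..L}. X i \<omega> \<notin> I p)"
        by (intro pred_intros_finite pred_intros_logic measurable_compose[OF X]) auto
      then show ?thesis
        by (simp add: B_def pred_def)
    qed
    have "prob (\<Union>p\<in>P. B p) \<le> (\<Sum>p\<in>P. prob (B p))"
      using fP B by (intro finite_measure_subadditive_finite) auto
    also have "\<dots> \<le> (\<Sum>p\<in>P. exp (- t * L))"
      unfolding B_def by (intro sum_mono prob_never_le_exp[OF assms(7,8)]) (auto simp: P_def)
    also have "\<dots> \<le> (real n)\<^sup>2 * exp (- t * L)"
      using of_nat_mono[OF cP, where 'a = real] by (simp add: mult_right_mono)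
    also have "\<dots> \<le> \<epsilon>"
      unfolding t_def by (rule threshold_union_bound) (use n assms in auto)
    finally have "1 - \<epsilon> \<le> prob (space M - (\<Union>p\<in>P. B p))"
      using fP B by (subst prob_compl) auto
    also have "\<dots> \<le> prob {\<omega> \<in> space M. tv_dist ?\<mu> (uniform_coloring q F V (?E \<omega>)) < \<gamma>}"
    \<comment> \<open>The inclusion of events holds only almost everywhere: the samples are known by
      their law, so they may fail to be colorings on a null set.\<close>
    proof (rule finite_measure_mono_AE)
      have "AE \<omega> in M. X i \<omega> \<in> H_colorings q F V E" if "i \<in> {1..L}" for i
      proof (rule AE_distrD[OF X[OF that]])
        show "AE \<sigma> in distr M (count_space UNIV) (X i). \<sigma> \<in> H_colorings q F V E"
          using assms(5) finite_H_colorings[OF fV, of q F E]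
          unfolding assms(8)[OF that] by (simp add: AE_measure_pmf_iff uniform_coloring_def)
      qed
      then have "AE \<omega> in M. \<forall>i\<in>{1..L}. X i \<omega> \<in> H_colorings q F V E"
        by (intro AE_finite_allI) auto
      then show "AE \<omega> in M. \<omega> \<in> space M - (\<Union>p\<in>P. B p) \<longrightarrow>
          \<omega> \<in> {\<omega> \<in> space M. tv_dist ?\<mu> (uniform_coloring q F V (?E \<omega>)) < \<gamma>}"
      proof eventually_elim
        fix \<omega> assume \<omega>: "\<forall>i\<in>{1..L}. X i \<omega> \<in> H_colorings q F V E"
        let ?Q = "{(u, v). u \<in> V \<and> v \<in> V \<and> u \<noteq> v \<and> {u, v} \<in> ?E \<omega>}"
        show "\<omega> \<in> space M - (\<Union>p\<in>P. B p) \<longrightarrow>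
          \<omega> \<in> {\<omega> \<in> space M. tv_dist ?\<mu> (uniform_coloring q F V (?E \<omega>)) < \<gamma>}"
        proof
          assume good: "\<omega> \<in> space M - (\<Union>p\<in>P. B p)"
          \<comment> \<open>No sample separates a learned edge, so a learned edge in
            \<open>P\<close> would put the outcome into its bad event.\<close>
          have le: "measure_pmf.prob ?\<mu> (I p) \<le> t" if p: "p \<in> ?Q" for p
          proof (rule ccontr)
            assume "\<not> ?thesis"
            then have "p \<in> P"
              using p by (auto simp: P_def)
            then obtain i where "i \<in> {1..L}" "X i \<omega> \<in> I p"
              using good by (auto simp: B_def)
            then show False
              using p not_in_learned_edges_iff[of "fst p" V "snd p" F L "\<lambda>i. X i \<omega>"]
              by (auto simp: I_def)
          qed
          \<comment> \<open>The goal is strict while \<open>le\<close> is not. Leaving out the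
            diagonal gives fewer than \<open>n^2\<close> pairs, and with \<open>t > 0\<close> this
            supplies the strictness, even for empty \<open>?Q\<close>.\<close>
          have "?Q \<subseteq> V \<times> V - (\<lambda>v. (v, v)) ` V"
            by auto
          then have "card ?Q \<le> card (V \<times> V - (\<lambda>v. (v, v)) ` V)"
            using fV by (intro card_mono) auto
          also have "\<dots> = n * n - n"
            using fV assms(4)
            by (subst card_Diff_subset) (auto simp: card_cartesian_product card_image inj_on_def)
          also have "\<dots> < n\<^sup>2"
            using n by (simp add: power2_eq_square)
          finally have cQ: "card ?Q < n\<^sup>2" .
          have "tv_dist ?\<mu> (uniform_coloring q F V (?E \<omega>))
              \<le> (\<Sum>(u, v)\<in>?Q. measure_pmf.prob ?\<mu> {\<sigma>. incompatible F (\<sigma> u) (\<sigma> v)})"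
          proof (rule tv_dist_uniform_coloring_le[OF fV])
            show "E \<subseteq> ?E \<omega>"
              using \<omega> by (intro subset_learned_edges[OF assms(3)]) auto
            show "H_colorings q F V (?E \<omega>) \<noteq> {}"
              using sample_in_learned_colorings[of "\<lambda>i. X i \<omega>" 1 q F V E L] \<omega> L
              by (metis atLeastAtMost_iff empty_iff less_one linorder_not_le order_refl)
          qed (rule learned_edges_subset)
          also have "\<dots> = (\<Sum>p\<in>?Q. measure_pmf.prob ?\<mu> (I p))"
            by (intro sum.cong) (auto simp: I_def)
          also have "\<dots> \<le> card ?Q * t"
            by (rule sum_bounded_above) (rule le)
          also have "\<dots> < (real n)\<^sup>2 * t"
            using of_nat_less_iff[where 'a = real, THEN iffD2, OF cQ] n assms(11)
            by (intro mult_strict_right_mono) (auto simp: t_def)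
          also have "\<dots> = \<gamma>"
            using n by (simp add: t_def)
          finally show "\<omega> \<in> {\<omega> \<in> space M. tv_dist ?\<mu> (uniform_coloring q F V (?E \<omega>)) < \<gamma>}"
            using good by simp
        qed
      qed
      \<comment> \<open>The event depends on the outcome only through the learned edge set, which is
        measurable into a discrete space, where every predicate is measurable.\<close>
      show "{\<omega> \<in> space M. tv_dist ?\<mu> (uniform_coloring q F V (?E \<omega>)) < \<gamma>} \<in> sets M"
        using measurable_compose[OF measurable_learned_edges[where L = L and X = X, OF fV X],
            where g = "\<lambda>S. tv_dist ?\<mu> (uniform_coloring q F V S) < \<gamma>" and L = "count_space UNIV"]
        by (simp add: pred_def)
    qed
    finally show ?thesis .
  qed
qed

end
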